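(* Let $Z \subseteq \mathbb{Z}^m$, let $C, A_1,\dots,A_m$ be real symmetric $n \times n$ matrices, and let $C - \sum_{i=1}^m A_i x_i \succeq 0$ be a linear matrix inequality satisfying Slater's condition with $\{A_1,\dots,A_m\} \subseteq \mathbb{Z}^{n\times n}$ finitely generative on $Z$. Then the spectrahedron $P = \{x \in \mathbb{R}^m : C - \sum_{i=1}^m A_i x_i \succeq 0\}$ can be described by a linear matrix inequality (i.e. is the solution set of a linear matrix inequality) that is totally dual integral on $Z$.
   Context: $[k]=\{1,\dots,k\}$, $\langle X,Y\rangle = \mathrm{tr}(X^\top Y)$, $\succeq 0$ (resp. $\succ 0$) denotes positive semidefinite (resp. positive definite). Slater's condition: there is $x \in \mathbb{R}^m$ with $C - \sum_i A_i x_i \succ 0$. Finitely generative: $\{A_1,\dots,A_m\}$ is finitely generative on $Z \subseteq \mathbb{Z}^m$ if there exists a finite set of integer positive semidefinite matrices $\mathcal{V} = \{V_1,\dots,V_k\}$ such that $\{X : \langle A_i, X\rangle = b_i,\ i \in [m],\ X \succeq 0\}$ is contained in $\mathrm{cone}(\mathcal{V})$ for all $b \in Z$. Property $(\mathrm{P}\mathbb{Z})_{\mathcal{V}}$: given a finite set $\mathcal{V} = \{V_1,\dots,V_k\}$ of positive semidefinite matrices (of the same order) with integer entries, a positive semidefinite matrix $X$ satisfies $(\mathrm{P}\mathbb{Z})_{\mathcal{V}}$ if $X = \sum_{j \in [k]} y_j V_j$ for some $y \in \mathbb{Z}^k_+$ (nonnegative integers). Total dual integrality: an LMI $\hat C -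 \sum_{i=1}^m \hat A_i x_i \succeq 0$ is totally dual integral on $Z \subseteq \mathbb{Z}^m$ if there exists a finite set $\mathcal{V}$ of integer positive semidefinite matrices such that, for every $b \in Z$, the dual semidefinite program $\inf\{\langle \hat C, X\rangle : \langle \hat A_i, X\rangle = b_i\ (i \in [m]),\ X \succeq 0\}$ of $\sup\{b^\top x : \hat C - \sum_{i} \hat A_i x_i \succeq 0\}$ has an optimal solution satisfying $(\mathrm{P}\mathbb{Z})_{\mathcal{V}}$ whenever it has an optimal solution. *)

theory Defs
  imports Complex_Main "Jordan_Normal_Form.Matrix"
begin

(* The order of the describing linear matrix inequality is existentially quantified in the
   theorem, so matrices of variable dimension with explicit carriers are used.
   Families indexed by [m] = {1,...,m} are indexed by {..<m} here. *)

definition trace_inner :: "real mat \<Rightarrow> real mat \<Rightarrow> real" where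
  "trace_inner X Y = (\<Sum>i<dim_row (X\<^sup>T * Y). (X\<^sup>T * Y) $$ (i, i))"

definition sym_mat :: "nat \<Rightarrow> real mat \<Rightarrow> bool" where
  "sym_mat n X \<longleftrightarrow> X \<in> carrier_mat n n \<and> X\<^sup>T = X"

definition psd :: "nat \<Rightarrow> real mat \<Rightarrow> bool" where
  "psd n X \<longleftrightarrow> sym_mat n X \<and> (\<forall>v\<in>carrier_vec n. v \<bullet> (X *\<^sub>v v) \<ge> 0)"

definition pos_def :: "nat \<Rightarrow> real mat \<Rightarrow> bool" where
  "pos_def n X \<longleftrightarrow> sym_mat n X \<and> (\<forall>v\<in>carrier_vec n. v \<noteq> 0\<^sub>v n \<longrightarrow> v \<bullet> (X *\<^sub>v v) > 0)"

definition int_mat :: "real mat \<Rightarrow> bool" where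
  "int_mat X \<longleftrightarrow> elements_mat X \<subseteq> \<int>"

definition lin_comb_mat :: "nat \<Rightarrow> ('i \<Rightarrow> real) \<Rightarrow> ('i \<Rightarrow> real mat) \<Rightarrow> 'i set \<Rightarrow> real mat" where
  "lin_comb_mat n c M I = mat n n (\<lambda>(r, s). \<Sum>i\<in>I. c i * M i $$ (r, s))"

definition lmi_mat :: "nat \<Rightarrow> nat \<Rightarrow> real mat \<Rightarrow> (nat \<Rightarrow> real mat) \<Rightarrow> real vec \<Rightarrow> real mat" where
  "lmi_mat n m C A x = C - lin_comb_mat n (\<lambda>i. x $ i) A {..<m}"

definition spectrahedron :: "nat \<Rightarrow> nat \<Rightarrow> real mat \<Rightarrow> (nat \<Rightarrow> real mat) \<Rightarrow> real vec set" where
  "spectrahedron n m C A = {x \<in> carrier_vec m. psd n (lmi_mat n m C A x)}"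

definition slater :: "nat \<Rightarrow> nat \<Rightarrow> real mat \<Rightarrow> (nat \<Rightarrow> real mat) \<Rightarrow> bool" where
  "slater n m C A \<longleftrightarrow> (\<exists>x\<in>carrier_vec m. pos_def n (lmi_mat n m C A x))"

definition dual_feasible :: "nat \<Rightarrow> nat \<Rightarrow> (nat \<Rightarrow> real mat) \<Rightarrow> int vec \<Rightarrow> real mat set" where
  "dual_feasible n m A b = {X. psd n X \<and> (\<forall>i<m. trace_inner (A i) X = of_int (b $ i))}"

definition dual_optimal ::
  "nat \<Rightarrow> nat \<Rightarrow> real mat \<Rightarrow> (nat \<Rightarrow> real mat) \<Rightarrow> int vec \<Rightarrow> real mat \<Rightarrow> bool" where
  "dual_optimal n m C A b X \<longleftrightarrow>
     X \<in> dual_feasible n m A b \<and>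
     (\<forall>Y\<in>dual_feasible n m A b. trace_inner C X \<le> trace_inner C Y)"

definition mat_cone :: "nat \<Rightarrow> real mat set \<Rightarrow> real mat set" where
  "mat_cone n \<V> = {lin_comb_mat n y (\<lambda>V. V) \<V> | y. \<forall>V\<in>\<V>. y V \<ge> 0}"

definition int_psd_set :: "nat \<Rightarrow> real mat set \<Rightarrow> bool" where
  "int_psd_set n \<V> \<longleftrightarrow> finite \<V> \<and> (\<forall>V\<in>\<V>. psd n V \<and> int_mat V)"

definition finitely_generative :: "nat \<Rightarrow> nat \<Rightarrow> (nat \<Rightarrow> real mat) \<Rightarrow> int vec set \<Rightarrow> bool" where
  "finitely_generative n m A Z \<longleftrightarrow>
     (\<exists>\<V>. int_psd_set n \<V> \<and> (\<forall>b\<in>Z. dual_feasible n m A b \<subseteq> mat_cone n \<V>))"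

definition PZ :: "nat \<Rightarrow> real mat set \<Rightarrow> real mat \<Rightarrow> bool" where
  "PZ n \<V> X \<longleftrightarrow> psd n X \<and> (\<exists>y :: real mat \<Rightarrow> nat. X = lin_comb_mat n (\<lambda>V. real (y V)) (\<lambda>V. V) \<V>)"

definition totally_dual_integral ::
  "nat \<Rightarrow> nat \<Rightarrow> real mat \<Rightarrow> (nat \<Rightarrow> real mat) \<Rightarrow> int vec set \<Rightarrow> bool" where
  "totally_dual_integral n m C A Z \<longleftrightarrow>
     (\<exists>\<V>. int_psd_set n \<V> \<and>
        (\<forall>b\<in>Z. (\<exists>X. dual_optimal n m C A b X) \<longrightarrow> (\<exists>X. dual_optimal n m C A b X \<and> PZ n \<V> X)))"

end

theory Submission
  imports Defs "HOL-Library.FuncSet"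
begin

text \<open>
  For \<open>b \<in> Z\<close> the dual program lives in \<open>cone \<V>\<close>, so it is a linear program in the
  multipliers \<open>y\<close> of the generators, with integral constraint data \<open>\<langle>A\<^sub>i, V\<rangle>\<close>. As in the
  theorem of Giles and Pulleyblank, split an optimal \<open>y\<close> into its integral and fractional parts.
  The fractional parts produce only finitely many pairs (support, integral constraint values), so
  finitely many \<open>W\<^sub>k \<in> cone \<V>\<close> represent all of them. Since a feasible point whose support lies
  inside that of an optimal point is itself optimal, replacing every part by its representative
  yields an optimal natural combination of the \<open>W\<^sub>k\<close>. The new inequality is the direct sum of the
  old one with the redundant scalar inequalities \<open>\<langle>W\<^sub>k, C - \<Sum> x\<^sub>i A\<^sub>i\<rangle> \<ge> 0\<close>, and the required
  integral generators are the diagonal matrix units of the new rows.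
\<close>

section \<open>Integral multipliers for linear programs\<close>

text \<open>Since \<open>y'\<close> vanishes wherever \<open>y\<close> does, a small step from
  \<open>y\<close> in the direction \<open>y - y'\<close> keeps all multipliers nonnegative, and it
  leaves the constraint values unchanged. If \<open>y'\<close> were costlier than \<open>y\<close>,
  this step would lower the optimal cost.\<close>

lemma lp_optimal_of_support_subset:
  fixes a :: "'v \<Rightarrow> nat \<Rightarrow> real" and c y y' :: "'v \<Rightarrow> real"
  assumes fin: "finite V"
    and y: "\<And>v. v \<in> V \<Longrightarrow> 0 \<le> y v"
    and y': "\<And>v. v \<in> V \<Longrightarrow> 0 \<le> y' v"
    and supp: "\<And>v. v \<in> V \<Longrightarrow> y v = 0 \<Longrightarrow> y' v = 0"
    and eq: "\<And>i. i < m \<Longrightarrow> (\<Sum>v\<in>V. y' v * a v i) = (\<Sum>v\<in>V. y v * a v i)"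
    and opt: "\<And>z. (\<And>v. v \<in> V \<Longrightarrow> 0 \<le> z v) \<Longrightarrow>
      (\<And>i. i < m \<Longrightarrow> (\<Sum>v\<in>V. z v * a v i) = (\<Sum>v\<in>V. y v * a v i)) \<Longrightarrow>
      (\<Sum>v\<in>V. y v * c v) \<le> (\<Sum>v\<in>V. z v * c v)"
  shows "(\<Sum>v\<in>V. y' v * c v) \<le> (\<Sum>v\<in>V. y v * c v)"
proof -
  \<comment> \<open>\<open>M\<close> dominates every ratio \<open>y' v / y v\<close>; where
    \<open>y v = 0\<close> the quotient is 0 by convention, and \<open>y' v = 0\<close> there as
    well.\<close>
  define M where "M = (\<Sum>v\<in>V. y' v / y v)"
  have quot: "0 \<le> y' v / y v" if "v \<in> V" for v
    using y[OF that] y'[OF that] by simp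
  have M0: "0 \<le> M"
    unfolding M_def by (intro sum_nonneg quot)
  have le: "y' v \<le> M * y v" if "v \<in> V" for v
  proof (cases "y v = 0")
    case True
    then show ?thesis using supp that by simp
  next
    case False
    have "y' v / y v \<le> M"
      unfolding M_def using that fin quot by (intro member_le_sum) auto
    with False y[OF that] show ?thesis by (simp add: field_simps)
  qed
  \<comment> \<open>The competitor is \<open>w = y + (y - y') / (1 + M)\<close>; \<open>z\<close> is
    its multiple by \<open>1 + M\<close>, whose nonnegativity follows from
    \<open>y' \<le> M * y\<close> without division.\<close>
  define z where "z v = (1 + M) * y v + (y v - y' v)" for v
  define w where "w v = z v / (1 + M)" for v
  have w_eq: "(\<Sum>v\<in>V. w v * g v) =
      (\<Sum>v\<in>V. y v * g v) + ((\<Sum>v\<in>V. y v * g v) - (\<Sum>v\<in>V. y' v * g v)) / (1 + M)" for g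
  proof -
    have "w v * g v = y v * g v + (y v * g v - y' v * g v) / (1 + M)" for v
      unfolding w_def z_def using M0 by (simp add: field_simps)
    then show ?thesis
      by (simp add: sum.distrib sum_subtractf flip: sum_divide_distrib)
  qed
  have "(\<Sum>v\<in>V. y v * c v) \<le> (\<Sum>v\<in>V. w v * c v)"
  proof (rule opt)
    fix v assume "v \<in> V"
    with le[of v] y[of v] M0 have "0 \<le> z v"
      unfolding z_def by (simp add: algebra_simps)
    then show "0 \<le> w v" unfolding w_def using M0 by simp
  next
    fix i assume "i < m"
    then show "(\<Sum>v\<in>V. w v * a v i) = (\<Sum>v\<in>V. y v * a v i)"
      using eq w_eq by simp
  qed
  then show ?thesis
    using M0 by (simp add: w_eq zero_le_divide_iff)
qed

text \<open>The set \<open>T\<close> is fixed before \<open>y\<close> and \<open>c\<close>, so it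
  serves every integral right-hand side and every objective. An optimal \<open>y\<close> is the sum
  of \<open>p w\<close> copies of each unit vector and one fractional vector; each summand is
  exchanged for a member of \<open>T\<close> with the same support and the same constraint
  values.\<close>

lemma lp_finite_integral_generators:
  fixes a :: "'v \<Rightarrow> nat \<Rightarrow> real"
  assumes fin: "finite V"
    and a_int: "\<And>v i. v \<in> V \<Longrightarrow> i < m \<Longrightarrow> a v i \<in> \<int>"
  obtains T :: "('v \<Rightarrow> real) set"
  where "finite T" "T \<noteq> {}" "\<And>t v. t \<in> T \<Longrightarrow> v \<in> V \<Longrightarrow> 0 \<le> t v"
    "\<And>y c. (\<And>v. v \<in> V \<Longrightarrow> 0 \<le> y v) \<Longrightarrow>
      (\<And>i. i < m \<Longrightarrow> (\<Sum>v\<in>V. y v * a v i) \<in> \<int>) \<Longrightarrow>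
      (\<And>z. (\<And>v. v \<in> V \<Longrightarrow> 0 \<le> z v) \<Longrightarrow>
        (\<And>i. i < m \<Longrightarrow> (\<Sum>v\<in>V. z v * a v i) = (\<Sum>v\<in>V. y v * a v i)) \<Longrightarrow>
        (\<Sum>v\<in>V. y v * c v) \<le> (\<Sum>v\<in>V. z v * c v)) \<Longrightarrow>
      \<exists>k :: ('v \<Rightarrow> real) \<Rightarrow> nat.
        (\<forall>i<m. (\<Sum>t\<in>T. real (k t) * (\<Sum>v\<in>V. t v * a v i)) = (\<Sum>v\<in>V. y v * a v i)) \<and>
        (\<Sum>t\<in>T. real (k t) * (\<Sum>v\<in>V. t v * c v)) \<le> (\<Sum>v\<in>V. y v * c v)"
proof -
  \<comment> \<open>The bound 1 is not strict, so that \<open>S\<close> holds the unit vectors along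
    with the fractional parts.\<close>
  define S where "S = {t :: 'v \<Rightarrow> real. (\<forall>v\<in>V. 0 \<le> t v \<and> t v \<le> 1) \<and>
    (\<forall>i<m. (\<Sum>v\<in>V. t v * a v i) \<in> \<int>)}"
  \<comment> \<open>\<open>f\<close> records all that an exchange must preserve: the support and the
    constraint values. \<open>restrict\<close> makes the latter a member of a finite
    \<open>PiE\<close> set, since multipliers in [0, 1] give integers bounded by
    \<open>B i\<close>.\<close>
  define f where "f t = ({v \<in> V. t v \<noteq> 0}, restrict (\<lambda>i. \<Sum>v\<in>V. t v * a v i) {..<m})"
    for t :: "'v \<Rightarrow> real"
  define B where "B i = (\<Sum>v\<in>V. \<bar>a v i\<bar>)" for i
  have "f ` S \<subseteq> Pow V \<times> (PiE {..<m} (\<lambda>i. {x \<in> \<int>. \<bar>x\<bar> \<le> B i}))"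
  proof (rule image_subsetI)
    fix t assume t: "t \<in> S"
    have "\<bar>\<Sum>v\<in>V. t v * a v i\<bar> \<le> B i" for i
      unfolding B_def
    proof (rule order_trans[OF sum_abs], rule sum_mono)
      fix v assume "v \<in> V"
      with t have "\<bar>t v\<bar> \<le> 1" by (auto simp: S_def)
      then show "\<bar>t v * a v i\<bar> \<le> \<bar>a v i\<bar>"
        by (simp add: abs_mult mult_left_le_one_le)
    qed
    with t show "f t \<in> Pow V \<times> (PiE {..<m} (\<lambda>i. {x \<in> \<int>. \<bar>x\<bar> \<le> B i}))"
      by (auto simp: f_def S_def)
  qed
  moreover have "finite (Pow V \<times> (PiE {..<m} (\<lambda>i. {x \<in> \<int>. \<bar>x\<bar> \<le> B i})))"
    using fin by (intro finite_cartesian_product finite_PiE) (auto intro: finite_abs_int_segment)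
  ultimately have "finite (f ` S)" by (rule finite_subset)
  \<comment> \<open>Finitely many members of \<open>S\<close> already realise all values of
    \<open>f\<close>; \<open>rep\<close> sends each \<open>t\<close> in \<open>S\<close> to one of
    them with the same value.\<close>
  then obtain T where T: "T \<subseteq> S" "finite T" "f ` S = f ` T"
    using finite_subset_image[of "f ` S" f S] by auto
  have "\<exists>t'\<in>T. f t' = f t" if "t \<in> S" for t
    using T(3) that by (metis imageE imageI)
  then obtain rep where rep: "\<And>t. t \<in> S \<Longrightarrow> rep t \<in> T" "\<And>t. t \<in> S \<Longrightarrow> f (rep t) = f t"
    by metis
  have rep_supp: "rep t v = 0" if "t \<in> S" "v \<in> V" "t v = 0" for t v
    using rep(2)[OF that(1)] that by (auto simp: f_def)
  have rep_val: "(\<Sum>v\<in>V. rep t v * a v i) = (\<Sum>v\<in>V. t v * a v i)" if "t \<in> S" "i < m" for t i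
    using rep(2)[OF that(1)] that(2) by (auto simp: f_def restrict_def dest: fun_cong[of _ _ i])
  have T0: "0 \<le> t v" if "t \<in> T" "v \<in> V" for t v
    using that T(1) by (auto simp: S_def)
  have "(\<lambda>_. 0) \<in> S" by (simp add: S_def)
  then have "T \<noteq> {}" using rep(1) by auto
  define e :: "'v \<Rightarrow> 'v \<Rightarrow> real" where "e w v = of_bool (v = w)" for w v
  have e_val: "(\<Sum>v\<in>V. e w v * g v) = g w" if "w \<in> V" for w g
  proof -
    have "(\<Sum>v\<in>V. e w v * g v) = (\<Sum>v\<in>V. if v = w then g v else 0)"
      by (intro sum.cong) (auto simp: e_def)
    with that fin show ?thesis by simp
  qed
  have eS: "e w \<in> S" if "w \<in> V" for w
    using that a_int by (auto simp: S_def e_val) (auto simp: e_def)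
  show ?thesis
  proof (rule that[of T])
    fix y c :: "'v \<Rightarrow> real"
    assume y: "\<And>v. v \<in> V \<Longrightarrow> 0 \<le> y v"
      and y_int: "\<And>i. i < m \<Longrightarrow> (\<Sum>v\<in>V. y v * a v i) \<in> \<int>"
      and opt: "\<And>z. (\<And>v. v \<in> V \<Longrightarrow> 0 \<le> z v) \<Longrightarrow>
        (\<And>i. i < m \<Longrightarrow> (\<Sum>v\<in>V. z v * a v i) = (\<Sum>v\<in>V. y v * a v i)) \<Longrightarrow>
        (\<Sum>v\<in>V. y v * c v) \<le> (\<Sum>v\<in>V. z v * c v)"
    define p where "p v = nat \<lfloor>y v\<rfloor>" for v
    define r where "r v = frac (y v)" for v
    have split: "y v = real (p v) + r v" if "v \<in> V" for v
      using y[OF that] by (simp add: p_def r_def frac_def)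
    have y_split: "(\<Sum>v\<in>V. y v * g v) = (\<Sum>v\<in>V. real (p v) * g v) + (\<Sum>v\<in>V. r v * g v)" for g
      unfolding sum.distrib[symmetric] by (intro sum.cong refl) (simp add: split algebra_simps)
    \<comment> \<open>The integral part \<open>p\<close> has integral constraint values because the
      data are integral; subtracting them from those of \<open>y\<close> leaves integers.\<close>
    have rS: "r \<in> S"
    proof -
      have "(\<Sum>v\<in>V. r v * a v i) \<in> \<int>" if "i < m" for i
      proof -
        have "(\<Sum>v\<in>V. real (p v) * a v i) \<in> \<int>"
          using a_int that by (intro Ints_sum Ints_mult) auto
        with y_int[OF that] have "(\<Sum>v\<in>V. y v * a v i) - (\<Sum>v\<in>V. real (p v) * a v i) \<in> \<int>"
          by (rule Ints_diff)
        then show ?thesis unfolding y_split by simp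
      qed
      then show ?thesis
        by (auto simp: S_def r_def frac_ge_0 less_imp_le[OF frac_lt_1])
    qed
    \<comment> \<open>\<open>k t\<close> counts how often \<open>t\<close> occurs as a
      representative in the exchange, as different unit vectors may share one; \<open>y'\<close> is
      the resulting multiplier vector.\<close>
    define k where "k t = (\<Sum>w\<in>V. p w * of_bool (rep (e w) = t)) + of_bool (rep r = t)" for t
    define y' where "y' v = (\<Sum>w\<in>V. real (p w) * rep (e w) v) + rep r v" for v
    have k_sum: "(\<Sum>t\<in>T. real (k t) * F t) = (\<Sum>w\<in>V. real (p w) * F (rep (e w))) + F (rep r)"
      for F
    proof -
      have pick: "(\<Sum>t\<in>T. of_bool (s = t) * F t) = F s" if "s \<in> T" for s
      proof -
        have "(\<Sum>t\<in>T. of_bool (s = t) * F t) = (\<Sum>t\<in>T. if s = t then F t else 0)"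
          by (intro sum.cong) auto
        with that T(2) show ?thesis by simp
      qed
      have "(\<Sum>t\<in>T. real (k t) * F t) =
          (\<Sum>t\<in>T. (\<Sum>w\<in>V. real (p w) * (of_bool (rep (e w) = t) * F t)) + of_bool (rep r = t) * F t)"
        by (intro sum.cong refl) (simp add: k_def algebra_simps sum_distrib_left)
      also have "\<dots> = (\<Sum>w\<in>V. real (p w) * (\<Sum>t\<in>T. of_bool (rep (e w) = t) * F t))
          + (\<Sum>t\<in>T. of_bool (rep r = t) * F t)"
        unfolding sum.distrib sum_distrib_left by (subst sum.swap) (rule refl)
      also have "\<dots> = (\<Sum>w\<in>V. real (p w) * F (rep (e w))) + F (rep r)"
        using pick rep(1) eS rS by simp
      finally show ?thesis .
    qed
    have k_y': "(\<Sum>t\<in>T. real (k t) * (\<Sum>v\<in>V. t v * g v)) = (\<Sum>v\<in>V. y' v * g v)" for g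
    proof -
      have "(\<Sum>v\<in>V. y' v * g v) =
          (\<Sum>v\<in>V. \<Sum>w\<in>V. real (p w) * (rep (e w) v * g v)) + (\<Sum>v\<in>V. rep r v * g v)"
        by (simp add: y'_def algebra_simps sum.distrib sum_distrib_left)
      also have "(\<Sum>v\<in>V. \<Sum>w\<in>V. real (p w) * (rep (e w) v * g v)) =
          (\<Sum>w\<in>V. real (p w) * (\<Sum>v\<in>V. rep (e w) v * g v))"
        by (subst sum.swap) (simp add: sum_distrib_left)
      finally show ?thesis by (simp add: k_sum)
    qed
    have y'_val: "(\<Sum>v\<in>V. y' v * a v i) = (\<Sum>v\<in>V. y v * a v i)" if "i < m" for i
      unfolding k_y'[symmetric] k_sum y_split using that by (simp add: rep_val eS rS e_val)
    have "(\<Sum>v\<in>V. y' v * c v) \<le> (\<Sum>v\<in>V. y v * c v)"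
    proof (rule lp_optimal_of_support_subset[OF fin y _ _ y'_val opt])
      fix v assume v: "v \<in> V"
      show "0 \<le> y' v"
        unfolding y'_def using v rep(1) eS rS T0
        by (intro add_nonneg_nonneg sum_nonneg mult_nonneg_nonneg) auto
      \<comment> \<open>If \<open>y v = 0\<close>, then \<open>p v = 0\<close> removes the summand
        \<open>w = v\<close>. For \<open>w \<noteq> v\<close> the unit vector \<open>e w\<close>
        vanishes at \<open>v\<close>, hence so does its representative.\<close>
      show "y' v = 0" if "y v = 0"
      proof -
        have "real (p w) * rep (e w) v = 0" if "w \<in> V" for w
        proof (cases "w = v")
          case True
          then show ?thesis using \<open>y v = 0\<close> by (simp add: p_def)
        next
          case False
          then show ?thesis using rep_supp[OF eS[OF that] v] by (simp add: e_def)
        qed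
        then have "(\<Sum>w\<in>V. real (p w) * rep (e w) v) = 0"
          by (intro sum.neutral) blast
        moreover have "rep r v = 0"
          using rep_supp[OF rS v] \<open>y v = 0\<close> by (simp add: r_def)
        ultimately show ?thesis by (simp add: y'_def)
      qed
    qed auto
    then show "\<exists>k :: ('v \<Rightarrow> real) \<Rightarrow> nat.
        (\<forall>i<m. (\<Sum>t\<in>T. real (k t) * (\<Sum>v\<in>V. t v * a v i)) = (\<Sum>v\<in>V. y v * a v i)) \<and>
        (\<Sum>t\<in>T. real (k t) * (\<Sum>v\<in>V. t v * c v)) \<le> (\<Sum>v\<in>V. y v * c v)"
      by (intro exI[of _ k]) (simp add: k_y' y'_val)
  qed (use T(2) \<open>T \<noteq> {}\<close> T0 in auto)
qed

section \<open>Positive semidefinite matrices\<close>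

text \<open>
  Cholesky elimination: subtracting the rank-one matrix of a pivot row keeps \<open>a\<close> positive
  semidefinite, kills a diagonal entry and revives none.
\<close>

lemma psd_sum_mult_nonneg:
  fixes a b :: "nat \<Rightarrow> nat \<Rightarrow> real"
  assumes "\<And>i j. i < n \<Longrightarrow> j < n \<Longrightarrow> a i j = a j i"
    and "\<And>f. 0 \<le> (\<Sum>i<n. \<Sum>j<n. f i * a i j * f j)"
    and b: "\<And>f. 0 \<le> (\<Sum>i<n. \<Sum>j<n. f i * b i j * f j)"
  shows "0 \<le> (\<Sum>i<n. \<Sum>j<n. a i j * b i j)"
  using assms(1,2)
proof (induction "card {i \<in> {..<n}. a i i \<noteq> 0}" arbitrary: a rule: less_induct)
  case less
  note sym = less.prems(1) and psd = less.prems(2)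
  define d :: "nat \<Rightarrow> nat \<Rightarrow> real" where "d p i = of_bool (i = p)" for p i
  have dl: "(\<Sum>i<n. d p i * g i) = g p" if "p < n" for p g
  proof -
    have "(\<Sum>i<n. d p i * g i) = (\<Sum>i<n. if i = p then g i else 0)"
      by (intro sum.cong) (auto simp: d_def)
    with that show ?thesis by simp
  qed
  \<comment> \<open>The quadratic form of \<open>c\<close> at \<open>f + t * d p\<close>, expanded
    in powers of \<open>t\<close>. It serves both cases below.\<close>
  have psd2: "0 \<le> (\<Sum>i<n. \<Sum>j<n. f i * c i j * f j) + 2 * t * (\<Sum>i<n. f i * c i p) + t\<^sup>2 * c p p"
    if "\<And>f. 0 \<le> (\<Sum>i<n. \<Sum>j<n. f i * c i j * f j)" "\<And>i j. i < n \<Longrightarrow> j < n \<Longrightarrow> c i j = c j i"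
      "p < n" for f t p and c :: "nat \<Rightarrow> nat \<Rightarrow> real"
  proof -
    have "(\<Sum>i<n. \<Sum>j<n. (f i + t * d p i) * c i j * (f j + t * d p j)) =
        (\<Sum>i<n. \<Sum>j<n. f i * c i j * f j) + t * (\<Sum>i<n. d p i * (\<Sum>j<n. c i j * f j))
        + t * (\<Sum>i<n. f i * (\<Sum>j<n. d p j * c i j))
        + t\<^sup>2 * (\<Sum>i<n. d p i * (\<Sum>j<n. d p j * c i j))"
      by (simp add: algebra_simps sum.distrib sum_distrib_left power2_eq_square)
    also have "\<dots> = (\<Sum>i<n. \<Sum>j<n. f i * c i j * f j) + t * (\<Sum>j<n. c p j * f j)
        + t * (\<Sum>i<n. f i * c i p) + t\<^sup>2 * c p p"
      using \<open>p < n\<close> by (simp add: dl)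
    also have "(\<Sum>j<n. c p j * f j) = (\<Sum>i<n. f i * c i p)"
      using that by (intro sum.cong) auto
    finally show ?thesis
      using that(1)[of "\<lambda>i. f i + t * d p i"] by (simp add: algebra_simps)
  qed
  have diag: "0 \<le> c p p" if "\<And>f. 0 \<le> (\<Sum>i<n. \<Sum>j<n. f i * c i j * f j)" "p < n"
    for p and c :: "nat \<Rightarrow> nat \<Rightarrow> real"
  proof -
    have "(\<Sum>i<n. \<Sum>j<n. d p i * c i j * d p j) = (\<Sum>i<n. d p i * (\<Sum>j<n. d p j * c i j))"
      by (simp add: sum_distrib_left mult_ac)
    then show ?thesis using that(1)[of "d p"] that(2) by (simp add: dl)
  qed
  show ?case
  proof (cases "\<forall>p<n. a p p = 0")
    case True
    \<comment> \<open>With a zero diagonal the form at \<open>d q + t * d p\<close> is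
      \<open>2 * t * a q p\<close>; being nonnegative for both signs of \<open>t\<close>, it must
      vanish.\<close>
    have "a q p = 0" if pq: "p < n" "q < n" for p q
    proof -
      have "(\<Sum>i<n. \<Sum>j<n. d q i * a i j * d q j) = (\<Sum>i<n. d q i * (\<Sum>j<n. d q j * a i j))"
        by (simp add: sum_distrib_left mult_ac)
      with pq True have "0 \<le> 2 * t * a q p" for t
        using psd2[OF psd sym pq(1), of "d q" t] by (simp add: dl)
      from this[of 1] this[of "-1"] show ?thesis by simp
    qed
    then show ?thesis by simp
  next
    case False
    then obtain p where p: "p < n" "a p p \<noteq> 0" by auto
    with diag[OF psd p(1)] have app: "a p p > 0" by simp
    \<comment> \<open>The Schur complement of the pivot \<open>a p p\<close>.\<close>
    define a' where "a' i j = a i j - a i p * a j p / a p p" for i j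
    have sym': "a' i j = a' j i" if "i < n" "j < n" for i j
      using sym[OF that] by (simp add: a'_def)
    have rank1: "(\<Sum>i<n. \<Sum>j<n. f i * (a i p * a j p / a p p) * f j) = (\<Sum>i<n. f i * a i p)\<^sup>2 / a p p"
      for f
      by (simp add: power2_eq_square sum_product sum_divide_distrib mult_ac)
    have psd': "0 \<le> (\<Sum>i<n. \<Sum>j<n. f i * a' i j * f j)" for f
    proof -
      define u where "u = (\<Sum>i<n. f i * a i p)"
      \<comment> \<open>The value \<open>t = - u / a p p\<close> minimises the quadratic in
        \<open>t\<close>; the minimum is the form of \<open>a'\<close> at \<open>f\<close>.\<close>
      have "0 \<le> (\<Sum>i<n. \<Sum>j<n. f i * a i j * f j) + 2 * (- u / a p p) * u + (- u / a p p)\<^sup>2 * a p p"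
        unfolding u_def by (rule psd2[OF psd sym p(1)])
      also have "\<dots> = (\<Sum>i<n. \<Sum>j<n. f i * a i j * f j) - u\<^sup>2 / a p p"
        using app by (simp add: field_simps power2_eq_square)
      also have "\<dots> = (\<Sum>i<n. \<Sum>j<n. f i * a' i j * f j)"
        unfolding u_def rank1[symmetric] a'_def
        by (simp add: algebra_simps sum_subtractf)
      finally show ?thesis .
    qed
    have "{i \<in> {..<n}. a' i i \<noteq> 0} \<subset> {i \<in> {..<n}. a i i \<noteq> 0}"
    proof (rule psubsetI)
      show "{i \<in> {..<n}. a' i i \<noteq> 0} \<subseteq> {i \<in> {..<n}. a i i \<noteq> 0}"
      proof safe
        fix i assume i: "i < n" "a i i = 0" "a' i i \<noteq> 0"
        have "a' i i \<le> 0" using i(2) app by (simp add: a'_def)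
        with diag[OF psd' i(1)] i(3) show False by simp
      qed
      have "a' p p = 0" using app by (simp add: a'_def)
      with p show "{i \<in> {..<n}. a' i i \<noteq> 0} \<noteq> {i \<in> {..<n}. a i i \<noteq> 0}" by auto
    qed
    then have "card {i \<in> {..<n}. a' i i \<noteq> 0} < card {i \<in> {..<n}. a i i \<noteq> 0}"
      by (intro psubset_card_mono) auto
    then have "0 \<le> (\<Sum>i<n. \<Sum>j<n. a' i j * b i j)"
      by (rule less.hyps) (use sym' psd' in auto)
    \<comment> \<open>The removed rank-one part contributes the form of \<open>b\<close> at the
      pivot column of \<open>a\<close>, divided by the pivot.\<close>
    moreover have "0 \<le> (\<Sum>i<n. \<Sum>j<n. a i p * b i j * a j p) / a p p"
      using b[of "\<lambda>i. a i p"] app by simp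
    moreover have "(\<Sum>i<n. \<Sum>j<n. a i j * b i j) =
        (\<Sum>i<n. \<Sum>j<n. a' i j * b i j) + (\<Sum>i<n. \<Sum>j<n. a i p * b i j * a j p) / a p p"
      unfolding sum_divide_distrib sum.distrib[symmetric]
      by (intro sum.cong refl) (simp add: a'_def field_simps)
    ultimately show ?thesis by simp
  qed
qed

section \<open>Trace inner products and quadratic forms as double sums\<close>

lemma trace_inner_eq:
  assumes "X \<in> carrier_mat n n" "Y \<in> carrier_mat n n"
  shows "trace_inner X Y = (\<Sum>i<n. \<Sum>j<n. X $$ (i, j) * Y $$ (i, j))"
proof -
  have "trace_inner X Y = (\<Sum>i<n. \<Sum>j<n. X $$ (j, i) * Y $$ (j, i))"
    using assms by (auto simp: trace_inner_def scalar_prod_def atLeast0LessThan intro!: sum.cong)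
  then show ?thesis by (subst (asm) sum.swap)
qed

lemma sym_mat_iff:
  "sym_mat n X \<longleftrightarrow> X \<in> carrier_mat n n \<and> (\<forall>i<n. \<forall>j<n. X $$ (i, j) = X $$ (j, i))"
proof (cases "X \<in> carrier_mat n n")
  case True
  have "X\<^sup>T = X \<longleftrightarrow> (\<forall>i<n. \<forall>j<n. X $$ (i, j) = X $$ (j, i))"
  proof
    assume "X\<^sup>T = X"
    then show "\<forall>i<n. \<forall>j<n. X $$ (i, j) = X $$ (j, i)"
      using True by (metis carrier_matD index_transpose_mat(1))
  qed (use True in \<open>auto intro!: eq_matI\<close>)
  with True show ?thesis by (simp add: sym_mat_def)
qed (simp add: sym_mat_def)

lemma psd_iff:
  "psd n X \<longleftrightarrow> sym_mat n X \<and> (\<forall>f. 0 \<le> (\<Sum>i<n. \<Sum>j<n. f i * X $$ (i, j) * f j))"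
proof (cases "sym_mat n X")
  case True
  then have X: "X \<in> carrier_mat n n" by (simp add: sym_mat_def)
  have quad: "v \<bullet> (X *\<^sub>v v) = (\<Sum>i<n. \<Sum>j<n. v $ i * X $$ (i, j) * v $ j)"
    if "v \<in> carrier_vec n" for v
    using that X
    by (auto simp: scalar_prod_def atLeast0LessThan sum_distrib_left mult_ac intro!: sum.cong)
  have "(\<forall>v\<in>carrier_vec n. 0 \<le> v \<bullet> (X *\<^sub>v v)) \<longleftrightarrow>
      (\<forall>f. 0 \<le> (\<Sum>i<n. \<Sum>j<n. f i * X $$ (i, j) * f j))"
  proof
    assume *: "\<forall>v\<in>carrier_vec n. 0 \<le> v \<bullet> (X *\<^sub>v v)"
    show "\<forall>f. 0 \<le> (\<Sum>i<n. \<Sum>j<n. f i * X $$ (i, j) * f j)"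
    proof
      fix f
      show "0 \<le> (\<Sum>i<n. \<Sum>j<n. f i * X $$ (i, j) * f j)"
        using *[rule_format, of "vec n f"] quad[of "vec n f"] by simp
    qed
  qed (simp add: quad)
  with True show ?thesis by (simp add: psd_def)
qed (simp add: psd_def)

lemma psd_carrier: "psd n X \<Longrightarrow> X \<in> carrier_mat n n"
  by (simp add: psd_def sym_mat_def)

lemma psd_quad_nonneg: "psd n X \<Longrightarrow> 0 \<le> (\<Sum>i<n. \<Sum>j<n. f i * X $$ (i, j) * f j)"
  by (simp add: psd_iff)

text \<open>One half of the self-duality of the semidefinite cone; it makes the added scalar
  inequalities redundant.\<close>

lemma trace_inner_psd_nonneg:
  assumes "psd n X" "psd n Y"
  shows "0 \<le> trace_inner X Y"
  using assms psd_sum_mult_nonneg[of n "\<lambda>i j. X $$ (i, j)" "\<lambda>i j. Y $$ (i, j)"]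
  by (simp add: trace_inner_eq[OF assms[THEN psd_carrier]]) (simp add: psd_iff sym_mat_iff)

lemma lin_comb_mat_carrier [simp]: "lin_comb_mat n c M I \<in> carrier_mat n n"
  by (simp add: lin_comb_mat_def)

lemma lin_comb_mat_index [simp]:
  "i < n \<Longrightarrow> j < n \<Longrightarrow> lin_comb_mat n c M I $$ (i, j) = (\<Sum>k\<in>I. c k * M k $$ (i, j))"
  by (simp add: lin_comb_mat_def)

lemma trace_inner_commute:
  "X \<in> carrier_mat n n \<Longrightarrow> Y \<in> carrier_mat n n \<Longrightarrow> trace_inner X Y = trace_inner Y X"
  by (simp add: trace_inner_eq mult.commute)

lemma trace_inner_lin_comb_mat:
  assumes "X \<in> carrier_mat n n" "\<And>k. k \<in> I \<Longrightarrow> M k \<in> carrier_mat n n"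
  shows "trace_inner X (lin_comb_mat n c M I) = (\<Sum>k\<in>I. c k * trace_inner X (M k))"
proof -
  have "trace_inner X (lin_comb_mat n c M I) =
      (\<Sum>i<n. \<Sum>j<n. \<Sum>k\<in>I. c k * (X $$ (i, j) * M k $$ (i, j)))"
    using assms by (simp add: trace_inner_eq[of _ n] sum_distrib_left mult_ac)
  also have "\<dots> = (\<Sum>i<n. \<Sum>k\<in>I. \<Sum>j<n. c k * (X $$ (i, j) * M k $$ (i, j)))"
    by (intro sum.cong refl sum.swap)
  also have "\<dots> = (\<Sum>k\<in>I. \<Sum>i<n. \<Sum>j<n. c k * (X $$ (i, j) * M k $$ (i, j)))"
    by (rule sum.swap)
  also have "\<dots> = (\<Sum>k\<in>I. c k * trace_inner X (M k))"
    using assms by (intro sum.cong refl) (simp add: trace_inner_eq[of _ n] sum_distrib_left)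
  finally show ?thesis .
qed

lemma psd_lin_comb_mat:
  assumes "\<And>k. k \<in> I \<Longrightarrow> psd n (M k)" "\<And>k. k \<in> I \<Longrightarrow> 0 \<le> c k"
  shows "psd n (lin_comb_mat n c M I)"
  unfolding psd_iff
proof (intro conjI allI)
  have "M k $$ (i, j) = M k $$ (j, i)" if "k \<in> I" "i < n" "j < n" for i j k
    using assms(1)[OF that(1)] that by (simp add: psd_iff sym_mat_iff)
  then show "sym_mat n (lin_comb_mat n c M I)"
    by (simp add: sym_mat_iff)
next
  fix f
  have "(\<Sum>i<n. \<Sum>j<n. f i * lin_comb_mat n c M I $$ (i, j) * f j) =
      (\<Sum>i<n. \<Sum>j<n. \<Sum>k\<in>I. c k * (f i * M k $$ (i, j) * f j))"
    by (simp add: sum_distrib_left sum_distrib_right mult_ac)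
  also have "\<dots> = (\<Sum>i<n. \<Sum>k\<in>I. \<Sum>j<n. c k * (f i * M k $$ (i, j) * f j))"
    by (intro sum.cong refl sum.swap)
  also have "\<dots> = (\<Sum>k\<in>I. \<Sum>i<n. \<Sum>j<n. c k * (f i * M k $$ (i, j) * f j))"
    by (rule sum.swap)
  also have "\<dots> = (\<Sum>k\<in>I. c k * (\<Sum>i<n. \<Sum>j<n. f i * M k $$ (i, j) * f j))"
    by (simp add: sum_distrib_left)
  finally show "0 \<le> (\<Sum>i<n. \<Sum>j<n. f i * lin_comb_mat n c M I $$ (i, j) * f j)"
    using assms by (auto simp: psd_iff intro!: sum_nonneg)
qed

lemma trace_inner_int_mat:
  assumes "X \<in> carrier_mat n n" "Y \<in> carrier_mat n n" "int_mat X" "int_mat Y"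
  shows "trace_inner X Y \<in> \<int>"
proof -
  have "M $$ (i, j) \<in> \<int>" if "M \<in> carrier_mat n n" "int_mat M" "i < n" "j < n" for M i j
    using that elements_matI[of M n n i j "M $$ (i, j)"] by (auto simp: int_mat_def)
  with assms show ?thesis
    unfolding trace_inner_eq[OF assms(1,2)] by (intro Ints_sum Ints_mult) auto
qed

section \<open>Direct sums with diagonal matrices\<close>

text \<open>Row \<open>n + k\<close> carries the scalar \<open>d k\<close>, so positive
  semidefiniteness of the direct sum adds \<open>K\<close> scalar inequalities to the one on
  \<open>M\<close>.\<close>

definition diag_ext :: "nat \<Rightarrow> nat \<Rightarrow> real mat \<Rightarrow> (nat \<Rightarrow> real) \<Rightarrow> real mat" where
  "diag_ext n K M d = mat (n + K) (n + K)
     (\<lambda>(i, j). if i < n \<and> j < n then M $$ (i, j) else if i = j then d (i - n) else 0)"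

lemma diag_ext_carrier [simp]: "diag_ext n K M d \<in> carrier_mat (n + K) (n + K)"
  by (simp add: diag_ext_def)

lemma sum_lessThan_add:
  fixes g :: "nat \<Rightarrow> real"
  shows "(\<Sum>i<n + K. g i) = (\<Sum>i<n. g i) + (\<Sum>k<K. g (n + k))"
  by (induction K) (simp_all add: add_ac)

text \<open>The weight \<open>g\<close> is arbitrary so that the formula covers both trace products
  (\<open>g\<close> the entries of a matrix) and quadratic forms
  (\<open>g i j = f i * f j\<close>).\<close>

lemma sum_diag_ext:
  fixes g :: "nat \<Rightarrow> nat \<Rightarrow> real"
  shows "(\<Sum>i<n + K. \<Sum>j<n + K. diag_ext n K M d $$ (i, j) * g i j) =
    (\<Sum>i<n. \<Sum>j<n. M $$ (i, j) * g i j) + (\<Sum>k<K. d k * g (n + k) (n + k))"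
proof -
  have "(\<Sum>j<n + K. diag_ext n K M d $$ (i, j) * g i j) = (\<Sum>j<n. M $$ (i, j) * g i j)"
    if "i < n" for i
    unfolding sum_lessThan_add using that by (simp add: diag_ext_def)
  moreover have "(\<Sum>j<n + K. diag_ext n K M d $$ (n + k, j) * g (n + k) j) =
      d k * g (n + k) (n + k)" if "k < K" for k
  proof -
    have "(\<Sum>j<K. diag_ext n K M d $$ (n + k, n + j) * g (n + k) (n + j)) =
        (\<Sum>j<K. if j = k then d k * g (n + k) (n + k) else 0)"
      using that by (intro sum.cong) (auto simp: diag_ext_def)
    with that show ?thesis
      unfolding sum_lessThan_add by (simp add: diag_ext_def)
  qed
  ultimately show ?thesis
    by (simp add: sum_lessThan_add[of "\<lambda>i. \<Sum>j<n + K. _ i j"])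
qed

lemma trace_inner_diag_ext:
  assumes "M \<in> carrier_mat n n" "X \<in> carrier_mat (n + K) (n + K)"
  shows "trace_inner (diag_ext n K M d) X =
    trace_inner M (mat n n (\<lambda>(i, j). X $$ (i, j))) + (\<Sum>k<K. d k * X $$ (n + k, n + k))"
  using assms by (simp add: trace_inner_eq[of _ "n + K"] trace_inner_eq[of _ n] sum_diag_ext)

lemma trace_inner_diag_ext2:
  assumes "M \<in> carrier_mat n n" "X \<in> carrier_mat n n"
  shows "trace_inner (diag_ext n K M d) (diag_ext n K X e) =
    trace_inner M X + (\<Sum>k<K. d k * e k)"
proof -
  have "mat n n (\<lambda>(i, j). diag_ext n K X e $$ (i, j)) = X"
    using assms by (auto simp: diag_ext_def intro!: eq_matI)
  with assms show ?thesis
    by (simp add: trace_inner_diag_ext) (simp add: diag_ext_def)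
qed

lemma sym_diag_ext: "sym_mat n M \<Longrightarrow> sym_mat (n + K) (diag_ext n K M d)"
  by (auto simp: sym_mat_iff) (auto simp: diag_ext_def)

lemma psd_submatrix:
  assumes "psd (n + K) X"
  shows "psd n (mat n n (\<lambda>(i, j). X $$ (i, j)))"
  unfolding psd_iff
proof (intro conjI allI)
  show "sym_mat n (mat n n (\<lambda>(i, j). X $$ (i, j)))"
    using assms by (simp add: psd_iff sym_mat_iff)
next
  fix f
  \<comment> \<open>The test vector is \<open>f\<close> padded with zeros.\<close>
  have "0 \<le> (\<Sum>i<n + K. \<Sum>j<n + K. (if i < n then f i else 0) * X $$ (i, j) * (if j < n then f j else 0))"
    using assms by (rule psd_quad_nonneg)
  then show "0 \<le> (\<Sum>i<n. \<Sum>j<n. f i * mat n n (\<lambda>(i, j). X $$ (i, j)) $$ (i, j) * f j)"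
    by (simp add: sum_lessThan_add)
qed

lemma psd_diag_nonneg:
  assumes "psd n X" "p < n"
  shows "0 \<le> X $$ (p, p)"
proof -
  have "0 \<le> (\<Sum>i<n. \<Sum>j<n. of_bool (i = p) * X $$ (i, j) * of_bool (j = p))"
    using assms(1) by (rule psd_quad_nonneg)
  also have "\<dots> = (\<Sum>i<n. if i = p then (\<Sum>j<n. if j = p then X $$ (i, j) else 0) else 0)"
    by (intro sum.cong refl) (auto intro: sum.cong)
  finally show ?thesis using assms by simp
qed

lemma psd_diag_ext_iff:
  assumes "M \<in> carrier_mat n n"
  shows "psd (n + K) (diag_ext n K M d) \<longleftrightarrow> psd n M \<and> (\<forall>k<K. 0 \<le> d k)"
proof
  assume L: "psd (n + K) (diag_ext n K M d)"
  have "mat n n (\<lambda>(i, j). diag_ext n K M d $$ (i, j)) = M"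
    using assms by (auto simp: diag_ext_def intro!: eq_matI)
  moreover have "0 \<le> d k" if "k < K" for k
    using psd_diag_nonneg[OF L, of "n + k"] that by (simp add: diag_ext_def)
  ultimately show "psd n M \<and> (\<forall>k<K. 0 \<le> d k)"
    using psd_submatrix[OF L] by simp
next
  assume R: "psd n M \<and> (\<forall>k<K. 0 \<le> d k)"
  show "psd (n + K) (diag_ext n K M d)"
    unfolding psd_iff
  proof (intro conjI allI)
    show "sym_mat (n + K) (diag_ext n K M d)"
      using R by (simp add: psd_iff sym_diag_ext)
    fix f
    have "0 \<le> (\<Sum>i<n. \<Sum>j<n. f i * M $$ (i, j) * f j)" using R by (simp add: psd_iff)
    moreover have "0 \<le> (\<Sum>k<K. d k * (f (n + k) * f (n + k)))"
      using R by (intro sum_nonneg) simp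
    moreover have "(\<Sum>i<n + K. \<Sum>j<n + K. f i * diag_ext n K M d $$ (i, j) * f j) =
        (\<Sum>i<n. \<Sum>j<n. f i * M $$ (i, j) * f j) + (\<Sum>k<K. d k * (f (n + k) * f (n + k)))"
      using sum_diag_ext[of n K M d "\<lambda>i j. f i * f j"] by (simp add: mult_ac)
    ultimately show "0 \<le> (\<Sum>i<n + K. \<Sum>j<n + K. f i * diag_ext n K M d $$ (i, j) * f j)"
      by simp
  qed
qed

section \<open>Linear matrix inequalities and their diagonal extensions\<close>

lemma lmi_mat_carrier [simp]: "lmi_mat n m C A x \<in> carrier_mat n n"
  by (simp add: lmi_mat_def minus_carrier_mat)

lemma lmi_mat_index [simp]:
  "i < n \<Longrightarrow> j < n \<Longrightarrow> lmi_mat n m C A x $$ (i, j) = C $$ (i, j) - (\<Sum>k<m. x $ k * A k $$ (i, j))"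
  by (simp add: lmi_mat_def lin_comb_mat_def)

lemma trace_inner_lmi_mat:
  assumes "W \<in> carrier_mat n n" "C \<in> carrier_mat n n" "\<And>i. i < m \<Longrightarrow> A i \<in> carrier_mat n n"
  shows "trace_inner (lmi_mat n m C A x) W =
    trace_inner C W - (\<Sum>i<m. x $ i * trace_inner (A i) W)"
proof -
  let ?L = "lin_comb_mat n (\<lambda>i. x $ i) A {..<m}"
  have "trace_inner (lmi_mat n m C A x) W = trace_inner C W - trace_inner ?L W"
    using assms(1,2)
    by (simp add: trace_inner_eq[of _ n] algebra_simps sum_subtractf)
  also have "trace_inner ?L W = trace_inner W ?L"
    by (rule trace_inner_commute) (use assms in auto)
  also have "\<dots> = (\<Sum>i<m. x $ i * trace_inner W (A i))"
    using assms by (intro trace_inner_lin_comb_mat) auto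
  also have "\<dots> = (\<Sum>i<m. x $ i * trace_inner (A i) W)"
    using assms by (intro sum.cong refl) (simp add: trace_inner_commute[of W n])
  finally show ?thesis .
qed

lemma lmi_mat_diag_ext:
  assumes "C \<in> carrier_mat n n"
  shows "lmi_mat (n + K) m (diag_ext n K C c) (\<lambda>i. diag_ext n K (A i) (a i)) x =
    diag_ext n K (lmi_mat n m C A x) (\<lambda>k. c k - (\<Sum>i<m. x $ i * a i k))"
  using assms by (intro eq_matI) (auto simp: diag_ext_def carrier_matD[OF lmi_mat_carrier])

text \<open>The matrices \<open>E p\<close> are the diagonal matrix units of the new rows. A matrix
  with zero old block and natural numbers on the new diagonal is a natural combination of
  them.\<close>

lemma PZ_diag_ext:
  fixes k :: "nat \<Rightarrow> nat" and n K :: nat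
  defines "E \<equiv> \<lambda>p. diag_ext n K (0\<^sub>m n n) (\<lambda>q. of_bool (q = p))"
  shows "int_psd_set (n + K) (E ` {..<K})"
    and "PZ (n + K) (E ` {..<K}) (diag_ext n K (0\<^sub>m n n) (\<lambda>q. real (k q)))"
proof -
  have zero: "psd n (0\<^sub>m n n)" by (simp add: psd_iff sym_mat_iff)
  have "int_mat (E p)" for p
    by (auto simp: int_mat_def E_def elements_mat_def diag_ext_def)
  then show "int_psd_set (n + K) (E ` {..<K})"
    by (auto simp: int_psd_set_def E_def psd_diag_ext_iff zero)
  \<comment> \<open>\<open>PZ\<close> attaches coefficients to matrices, not to indices; injectivity
    allows \<open>k\<close> to be transported along \<open>E\<close>.\<close>
  have inj: "inj_on E {..<K}"
  proof (rule inj_onI)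
    fix p q assume "p \<in> {..<K}" "q \<in> {..<K}" "E p = E q"
    then have "E p $$ (n + p, n + p) = E q $$ (n + p, n + p)" by simp
    with \<open>p \<in> {..<K}\<close> show "p = q" by (simp add: E_def diag_ext_def split: if_splits)
  qed
  define y where "y V = k (the_inv_into {..<K} E V)" for V
  have yE: "y (E p) = k p" if "p < K" for p
    using that inj by (simp add: y_def the_inv_into_f_f)
  have "diag_ext n K (0\<^sub>m n n) (\<lambda>q. real (k q)) =
      lin_comb_mat (n + K) (\<lambda>V. real (y V)) (\<lambda>V. V) (E ` {..<K})"
  proof (rule eq_matI)
    fix i j assume "i < dim_row (lin_comb_mat (n + K) (\<lambda>V. real (y V)) (\<lambda>V. V) (E ` {..<K}))"
      "j < dim_col (lin_comb_mat (n + K) (\<lambda>V. real (y V)) (\<lambda>V. V) (E ` {..<K}))"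
    then have ij: "i < n + K" "j < n + K" by (simp_all add: lin_comb_mat_def)
    have "lin_comb_mat (n + K) (\<lambda>V. real (y V)) (\<lambda>V. V) (E ` {..<K}) $$ (i, j) =
        (\<Sum>p<K. real (k p) * E p $$ (i, j))"
      using ij inj by (simp add: sum.reindex yE)
    \<comment> \<open>The guard \<open>n \<le> i\<close> matters: for \<open>i < n\<close> the
      truncated difference \<open>i - n\<close> is 0, which would otherwise select
      \<open>p = 0\<close>.\<close>
    also have "\<dots> = (\<Sum>p<K. if p = i - n then (if n \<le> i \<and> i = j then real (k p) else 0) else 0)"
      using ij by (intro sum.cong refl) (auto simp: E_def diag_ext_def)
    also have "\<dots> = diag_ext n K (0\<^sub>m n n) (\<lambda>q. real (k q)) $$ (i, j)"
      using ij by (auto simp: diag_ext_def)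
    finally show "diag_ext n K (0\<^sub>m n n) (\<lambda>q. real (k q)) $$ (i, j) =
        lin_comb_mat (n + K) (\<lambda>V. real (y V)) (\<lambda>V. V) (E ` {..<K}) $$ (i, j)" ..
  qed (simp_all add: diag_ext_def lin_comb_mat_def)
  moreover have "psd (n + K) (diag_ext n K (0\<^sub>m n n) (\<lambda>q. real (k q)))"
    by (simp add: psd_diag_ext_iff zero)
  ultimately show "PZ (n + K) (E ` {..<K}) (diag_ext n K (0\<^sub>m n n) (\<lambda>q. real (k q)))"
    unfolding PZ_def by blast
qed

section \<open>The extended inequality and its total dual integrality\<close>

theorem theorem9:
  fixes n m :: nat and C :: "real mat" and A :: "nat \<Rightarrow> real mat" and Z :: "int vec set"
  assumes "Z \<subseteq> carrier_vec m"
    and "sym_mat n C"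
    and "\<And>i. i < m \<Longrightarrow> sym_mat n (A i)"
    and "slater n m C A"
    and "\<And>i. i < m \<Longrightarrow> int_mat (A i)"
    and "finitely_generative n m A Z"
  shows "\<exists>N C' A'. 0 < N \<and> sym_mat N C' \<and> (\<forall>i<m. sym_mat N (A' i)) \<and>
           spectrahedron N m C' A' = spectrahedron n m C A \<and>
           totally_dual_integral N m C' A' Z"
proof -
  have C: "C \<in> carrier_mat n n" and A: "\<And>i. i < m \<Longrightarrow> A i \<in> carrier_mat n n"
    using assms(2,3) by (auto simp: sym_mat_def)
  obtain \<V> where \<V>: "int_psd_set n \<V>" "\<And>b. b \<in> Z \<Longrightarrow> dual_feasible n m A b \<subseteq> mat_cone n \<V>"
    using assms(6) by (auto simp: finitely_generative_def)
  have fin: "finite \<V>" and Vpsd: "\<And>V. V \<in> \<V> \<Longrightarrow> psd n V" and Vint: "\<And>V. V \<in> \<V> \<Longrightarrow> int_mat V"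
    using \<V>(1) by (auto simp: int_psd_set_def)
  note Vcar = psd_carrier[OF Vpsd]
  have a_int: "trace_inner (A i) V \<in> \<int>" if "V \<in> \<V>" "i < m" for V i
    using that by (intro trace_inner_int_mat[of _ n] A Vcar Vint assms(5))
  \<comment> \<open>Passing from multipliers to matrices turns the dual program on the cone into a
    linear program with integral data \<open>trace_inner (A i) V\<close>.\<close>
  define comb where "comb y = lin_comb_mat n y (\<lambda>V. V) \<V>" for y :: "real mat \<Rightarrow> real"
  have comb_car: "comb y \<in> carrier_mat n n" for y by (simp add: comb_def)
  have tr_comb: "trace_inner M (comb y) = (\<Sum>V\<in>\<V>. y V * trace_inner M V)"
    if "M \<in> carrier_mat n n" for M y
    unfolding comb_def using that Vcar by (rule trace_inner_lin_comb_mat)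
  have comb_psd: "psd n (comb y)" if "\<And>V. V \<in> \<V> \<Longrightarrow> 0 \<le> y V" for y
    unfolding comb_def using Vpsd that by (rule psd_lin_comb_mat)
  obtain T :: "(real mat \<Rightarrow> real) set" where T: "finite T" "T \<noteq> {}"
    "\<And>t V. t \<in> T \<Longrightarrow> V \<in> \<V> \<Longrightarrow> 0 \<le> t V"
    and T_gen: "\<And>y c. (\<And>v. v \<in> \<V> \<Longrightarrow> 0 \<le> y v) \<Longrightarrow>
      (\<And>i. i < m \<Longrightarrow> (\<Sum>v\<in>\<V>. y v * trace_inner (A i) v) \<in> \<int>) \<Longrightarrow>
      (\<And>z. (\<And>v. v \<in> \<V> \<Longrightarrow> 0 \<le> z v) \<Longrightarrow>
        (\<And>i. i < m \<Longrightarrow>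
          (\<Sum>v\<in>\<V>. z v * trace_inner (A i) v) = (\<Sum>v\<in>\<V>. y v * trace_inner (A i) v)) \<Longrightarrow>
        (\<Sum>v\<in>\<V>. y v * c v) \<le> (\<Sum>v\<in>\<V>. z v * c v)) \<Longrightarrow>
      \<exists>k :: (real mat \<Rightarrow> real) \<Rightarrow> nat.
        (\<forall>i<m. (\<Sum>t\<in>T. real (k t) * (\<Sum>v\<in>\<V>. t v * trace_inner (A i) v)) =
          (\<Sum>v\<in>\<V>. y v * trace_inner (A i) v)) \<and>
        (\<Sum>t\<in>T. real (k t) * (\<Sum>v\<in>\<V>. t v * c v)) \<le> (\<Sum>v\<in>\<V>. y v * c v)"
    by (rule lp_finite_integral_generators[OF fin, of m "\<lambda>V i. trace_inner (A i) V"])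
      (use a_int in auto)
  define K where "K = card T"
  obtain g where g: "bij_betw g {..<K} T"
    using ex_bij_betw_nat_finite[OF T(1)] by (auto simp: K_def atLeast0LessThan)
  \<comment> \<open>At least one new row makes the order \<open>n + K\<close> positive even for
    \<open>n = 0\<close>.\<close>
  have K0: "0 < K" using T(1,2) by (simp add: K_def card_gt_0_iff)
  define W where "W k = comb (g k)" for k
  have W_psd: "psd n (W k)" if "k < K" for k
    unfolding W_def using T(3) bij_betwE[OF g] that by (intro comb_psd) auto
  have W_car: "W k \<in> carrier_mat n n" for k
    by (simp add: W_def comb_car)
  \<comment> \<open>With these coefficients, row \<open>n + k\<close> of the new inequality is the
    trace product of \<open>W k\<close> with the old matrix expression.\<close>
  define C' where "C' = diag_ext n K C (\<lambda>k. trace_inner C (W k))"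
  define A' where "A' i = diag_ext n K (A i) (\<lambda>k. trace_inner (A i) (W k))" for i
  define E where "E = (\<lambda>p. diag_ext n K (0\<^sub>m n n) (\<lambda>q. of_bool (q = p)))"

  have "spectrahedron (n + K) m C' A' = spectrahedron n m C A"
  proof -
    have "psd (n + K) (lmi_mat (n + K) m C' A' x) \<longleftrightarrow> psd n (lmi_mat n m C A x)" for x
      unfolding C'_def A'_def lmi_mat_diag_ext[OF C] psd_diag_ext_iff[OF lmi_mat_carrier]
      using trace_inner_psd_nonneg[OF _ W_psd, of "lmi_mat n m C A x"]
      by (auto simp: trace_inner_lmi_mat[OF W_car C A])
    then show ?thesis by (simp add: spectrahedron_def)
  qed
  moreover have "totally_dual_integral (n + K) m C' A' Z"
    unfolding totally_dual_integral_def
  proof (intro exI[of _ "E ` {..<K}"] conjI ballI impI)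
    show "int_psd_set (n + K) (E ` {..<K})"
      unfolding E_def by (rule PZ_diag_ext)
    fix b assume b: "b \<in> Z" and "\<exists>X. dual_optimal (n + K) m C' A' b X"
    then obtain X where X: "X \<in> dual_feasible (n + K) m A' b"
      and X_opt: "\<And>Y. Y \<in> dual_feasible (n + K) m A' b \<Longrightarrow> trace_inner C' X \<le> trace_inner C' Y"
      by (auto simp: dual_optimal_def)
    have Xpsd: "psd (n + K) X" and Xb: "\<And>i. i < m \<Longrightarrow> trace_inner (A' i) X = of_int (b $ i)"
      using X by (auto simp: dual_feasible_def)
    define X0 where "X0 = mat n n (\<lambda>(i, j). X $$ (i, j))"
    have X0: "psd n X0" unfolding X0_def using Xpsd by (rule psd_submatrix)
    have Xd: "0 \<le> X $$ (n + k, n + k)" if "k < K" for k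
      using psd_diag_nonneg[OF Xpsd] that by simp
    \<comment> \<open>An extended solution is folded back into the old program as \<open>X1\<close>,
      the sum of the leading block \<open>X0\<close> and the \<open>W k\<close> weighted by the new
      diagonal entries of \<open>X\<close>. Index \<open>K\<close> is the slot for
      \<open>X0\<close>, with weight 1.\<close>
    define Q where "Q k = (if k = K then X0 else W k)" for k
    define q where "q k = (if k = K then 1 else X $$ (n + k, n + k))" for k
    define X1 where "X1 = lin_comb_mat n q Q {..K}"
    have tr_ext: "trace_inner (diag_ext n K M (\<lambda>k. trace_inner M (W k))) X = trace_inner M X1"
      if M: "M \<in> carrier_mat n n" for M
    proof -
      have "trace_inner M X1 = (\<Sum>k\<le>K. q k * trace_inner M (Q k))"
        unfolding X1_def using M W_car X0
        by (intro trace_inner_lin_comb_mat) (auto simp: Q_def psd_carrier)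
      also have "\<dots> = trace_inner M X0 + (\<Sum>k<K. X $$ (n + k, n + k) * trace_inner M (W k))"
        unfolding lessThan_Suc_atMost[symmetric] by (simp add: q_def Q_def)
      finally show ?thesis
        by (simp add: trace_inner_diag_ext[OF M psd_carrier[OF Xpsd]] X0_def mult.commute)
    qed
    have X1_feas: "X1 \<in> dual_feasible n m A b"
    proof -
      have "psd n X1"
        unfolding X1_def using X0 Xd W_psd by (intro psd_lin_comb_mat) (auto simp: q_def Q_def)
      with Xb show ?thesis by (auto simp: dual_feasible_def A'_def tr_ext A)
    qed
    \<comment> \<open>Padding an old solution with zeros gives an extended solution of equal cost,
      and \<open>X1\<close> costs as much as the optimal \<open>X\<close>.\<close>
    have X1_opt: "trace_inner C X1 \<le> trace_inner C Y" if Y: "Y \<in> dual_feasible n m A b" for Y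
    proof -
      have Ypsd: "psd n Y" using Y by (simp add: dual_feasible_def)
      note Ycar = psd_carrier[OF Ypsd]
      have "diag_ext n K Y (\<lambda>_. 0) \<in> dual_feasible (n + K) m A' b"
        using Y by (auto simp: dual_feasible_def A'_def psd_diag_ext_iff[OF Ycar]
            trace_inner_diag_ext2[OF A Ycar])
      from X_opt[OF this] show ?thesis
        by (simp add: C'_def tr_ext[OF C] trace_inner_diag_ext2[OF C Ycar])
    qed
    obtain y where y: "\<And>V. V \<in> \<V> \<Longrightarrow> 0 \<le> y V" "X1 = comb y"
      using \<V>(2)[OF b] X1_feas by (auto simp: mat_cone_def comb_def)
    have y_val: "(\<Sum>V\<in>\<V>. y V * trace_inner (A i) V) = of_int (b $ i)" if "i < m" for i
      using X1_feas that by (simp add: dual_feasible_def y(2) flip: tr_comb[OF A[OF that]])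
    have "\<exists>k :: (real mat \<Rightarrow> real) \<Rightarrow> nat.
        (\<forall>i<m. (\<Sum>t\<in>T. real (k t) * (\<Sum>V\<in>\<V>. t V * trace_inner (A i) V)) =
          (\<Sum>V\<in>\<V>. y V * trace_inner (A i) V)) \<and>
        (\<Sum>t\<in>T. real (k t) * (\<Sum>V\<in>\<V>. t V * trace_inner C V)) \<le> (\<Sum>V\<in>\<V>. y V * trace_inner C V)"
    \<comment> \<open>Every competitor \<open>z\<close> of the linear program yields a feasible
      matrix \<open>comb z\<close>, so optimality of \<open>X1\<close> makes \<open>y\<close>
      optimal.\<close>
    proof (rule T_gen[OF y(1)])
      fix z assume z: "\<And>v. v \<in> \<V> \<Longrightarrow> 0 \<le> z v"
        "\<And>i. i < m \<Longrightarrow> (\<Sum>v\<in>\<V>. z v * trace_inner (A i) v) = (\<Sum>v\<in>\<V>. y v * trace_inner (A i) v)"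
      have "comb z \<in> dual_feasible n m A b"
        by (auto simp: dual_feasible_def comb_psd z(1) tr_comb[OF A] z(2) y_val)
      from X1_opt[OF this] show "(\<Sum>V\<in>\<V>. y V * trace_inner C V) \<le> (\<Sum>V\<in>\<V>. z V * trace_inner C V)"
        by (simp add: y(2) tr_comb[OF C])
    qed (simp_all add: y_val)
    then obtain k :: "(real mat \<Rightarrow> real) \<Rightarrow> nat" where
      k_val: "\<And>i. i < m \<Longrightarrow> (\<Sum>t\<in>T. real (k t) * trace_inner (A i) (comb t)) = of_int (b $ i)"
      and k_cost: "(\<Sum>t\<in>T. real (k t) * trace_inner C (comb t)) \<le> trace_inner C X1"
      by (auto simp: tr_comb[OF A] tr_comb[OF C] y_val y(2))
    \<comment> \<open>All weight moves to the new rows: the diagonal entry for \<open>W p\<close> is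
      the multiplicity of \<open>g p\<close>, and the old block is zero. By \<open>tr_Y\<close> the
      constraint values and the cost are those of the natural combination just found.\<close>
    define Y where "Y = diag_ext n K (0\<^sub>m n n) (\<lambda>p. real (k (g p)))"
    have PZY: "PZ (n + K) (E ` {..<K}) Y"
      unfolding E_def Y_def by (rule PZ_diag_ext)
    have tr_Y: "trace_inner (diag_ext n K M (\<lambda>p. trace_inner M (W p))) Y =
        (\<Sum>t\<in>T. real (k t) * trace_inner M (comb t))" if M: "M \<in> carrier_mat n n" for M
    proof -
      have "trace_inner M (0\<^sub>m n n) = 0"
        using M by (simp add: trace_inner_eq)
      then have "trace_inner (diag_ext n K M (\<lambda>p. trace_inner M (W p))) Y =
          (\<Sum>p<K. real (k (g p)) * trace_inner M (comb (g p)))"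
        by (simp add: Y_def trace_inner_diag_ext2[OF M] W_def mult.commute)
      also have "\<dots> = (\<Sum>t\<in>T. real (k t) * trace_inner M (comb t))"
        by (rule sum.reindex_bij_betw[OF g])
      finally show ?thesis .
    qed
    have "Y \<in> dual_feasible (n + K) m A' b"
      using PZY by (auto simp: dual_feasible_def PZ_def A'_def tr_Y A k_val)
    moreover have "trace_inner C' Y \<le> trace_inner C' X"
      using k_cost by (simp add: C'_def tr_Y[OF C] tr_ext[OF C])
    ultimately have "dual_optimal (n + K) m C' A' b Y"
      using X_opt by (auto simp: dual_optimal_def intro: order_trans)
    with PZY show "\<exists>X. dual_optimal (n + K) m C' A' b X \<and> PZ (n + K) (E ` {..<K}) X"
      by blast
  qed
  moreover have "sym_mat (n + K) C'" "\<forall>i<m. sym_mat (n + K) (A' i)"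
    using assms(2,3) by (simp_all add: C'_def A'_def sym_diag_ext)
  ultimately show ?thesis
    using K0 by (intro exI[of _ "n + K"] exI[of _ C'] exI[of _ A']) simp
qed

end
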